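(* Let $\mathbf{v}(t)$ be a rational vector field in $\mathbb{R}^3$ such that $\mathbf{v}(t)$ and $\mathbf{v}'(t)$ are linearly independent for all $t$, and let $\mathbf{r}(t)$ be a rational space curve in $\mathbb{R}^3$. Then $\mathbf{v}(t)$ is tangent to $\mathbf{r}(t)$ if and only if there exists a rational function $a_3(t)$ such that $$\mathbf{r}(t)=a_1(t)\,\mathbf{v}(t)+a_2(t)\,\mathbf{v}'(t)+a_3(t)\,\mathbf{v}(t)\times\mathbf{v}'(t),$$ where $a_2(t)$ and $a_1(t)$ are obtained from (i.e. satisfy) the following two equations: for $a_2$, $$a_2\,\det(\mathbf{v},\mathbf{v}',\mathbf{v}'')+a_3'\,(\mathbf{v}\times\mathbf{v}')\cdot(\mathbf{v}\times\mathbf{v}')+a_3\,(\mathbf{v}\times\mathbf{v}')\cdot(\mathbf{v}\times\mathbf{v}'')=0,$$ and for $a_1$, $$(a_1+a_2')\left|\begin{array}{cc}\mathbf{v}\cdot\mathbf{v}' & \mathbf{v}'\cdot\mathbf{v}'\\ \mathbf{v}\cdot\mathbf{v} & \mathbf{v}\cdot\mathbf{v}'\end{array}\right|+a_2\left|\begin{array}{cc}\mathbf{v}\cdot\mathbf{v}' & \mathbf{v}'\cdot\mathbf{v}''\\ \mathbf{v}\cdot\mathbf{v} & \mathbf{v}\cdot\mathbf{v}''\end{array}\right|+a_3\,(\mathbf{v}\cdot\mathbf{v})\,\det(\mathbf{v},\mathbf{v}',\mathbf{v}'')=0.$$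
   Context: All functions are functions of a real parameter $t$ (ranging over an interval on which they are defined), and $'$ denotes $d/dt$. A rational function, rational vector field or rational curve has (component) functions that are quotients of real polynomials in $t$. The rational vector field $\mathbf{v}(t)$ is said to be tangent to $\mathbf{r}(t)$ if there exists a rational function $g(t)$ with $\mathbf{r}'(t)=g(t)\,\mathbf{v}(t)$. $\cdot$, $\times$ and $\det$ denote the Euclidean inner product, the cross product and the determinant of three vectors in $\mathbb{R}^3$, and vertical bars denote $2\times 2$ determinants. *)

theory Defs
  imports "HOL-Analysis.Analysis" "HOL-Computational_Algebra.Polynomial"
begin

unbundle cross3_syntax

(* Functions on an interval I are total functions whose values outside I are irrelevant.
   Requiring a denominator without zeros on I says that f is defined on all of I. *)
definition rational_on :: "real set \<Rightarrow> (real \<Rightarrow> real) \<Rightarrow> bool" where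
  "rational_on I f \<longleftrightarrow>
     (\<exists>p q :: real poly. \<forall>t\<in>I. poly q t \<noteq> 0 \<and> f t = poly p t / poly q t)"

definition rational_vec_on :: "real set \<Rightarrow> (real \<Rightarrow> real ^ 3) \<Rightarrow> bool" where
  "rational_vec_on I v \<longleftrightarrow> (\<forall>i. rational_on I (\<lambda>t. v t $ i))"

(* The derivative is taken within I, so it is one-sided at endpoints belonging to I
   and ignores the values outside I. *)
definition deriv_on :: "real set \<Rightarrow> (real \<Rightarrow> 'a::real_normed_vector) \<Rightarrow> real \<Rightarrow> 'a" where
  "deriv_on I f t = vector_derivative f (at t within I)"

definition tangent_on :: "real set \<Rightarrow> (real \<Rightarrow> real ^ 3) \<Rightarrow> (real \<Rightarrow> real ^ 3) \<Rightarrow> bool" where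
  "tangent_on I v r \<longleftrightarrow>
     (\<exists>g. rational_on I g \<and> (\<forall>t\<in>I. deriv_on I r t = g t *\<^sub>R v t))"

(* independent is a property of sets, and {x, x} is independent for x \<noteq> 0;
   linear independence of the pair needs distinctness as well. *)
definition lin_indep_pair :: "'a::real_vector \<Rightarrow> 'a \<Rightarrow> bool" where
  "lin_indep_pair x y \<longleftrightarrow> x \<noteq> y \<and> independent {x, y}"

definition det3 :: "real ^ 3 \<Rightarrow> real ^ 3 \<Rightarrow> real ^ 3 \<Rightarrow> real" where
  "det3 x y z = det (vector [x, y, z] :: real ^ 3 ^ 3)"

definition det2 :: "real \<Rightarrow> real \<Rightarrow> real \<Rightarrow> real \<Rightarrow> real" where
  "det2 a b c d = det (vector [vector [a, b], vector [c, d]] :: real ^ 2 ^ 2)"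

end

theory Submission
  imports Defs
begin

text \<open>
  Write \<open>w = v \<times> v'\<close>.  Since \<open>v\<close> and \<open>v'\<close> are independent, \<open>w\<close> never vanishes, and Cramer's rule
  expands every vector in the moving frame \<open>v, v', w\<close> with the common denominator \<open>w \<bullet> w\<close>
  (\<open>cross_frame_expansion\<close>).  Applied to \<open>r\<close>, this gives coefficients \<open>a1, a2, a3\<close> which are
  rational because \<open>r\<close>, \<open>v\<close> and \<open>v'\<close> are; applied to \<open>r'\<close>, it shows that \<open>r'\<close> is a multiple of
  \<open>v\<close> exactly when it is orthogonal to \<open>w\<close> and to \<open>v \<times> w\<close>, and that the factor is then the
  rational function \<open>(r' \<bullet> (v' \<times> w)) / (w \<bullet> w)\<close>.

  Because \<open>v' \<times> v' = 0\<close>, the frame vector \<open>w\<close> has derivative \<open>v \<times> v''\<close>, so differentiating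
  \<open>r = a1 v + a2 v' + a3 w\<close> gives
  \<open>r' = a1' v + (a1 + a2') v' + a2 v'' + a3' w + a3 (v \<times> v'')\<close>.
  The two scalar equations of the proposition are \<open>r' \<bullet> w = 0\<close> and \<open>r' \<bullet> (v \<times> w) = 0\<close> written
  out with this formula; \<open>a1'\<close> drops out of both since \<open>v\<close> is orthogonal to \<open>w\<close> and \<open>v \<times> w\<close>.
\<close>

section \<open>Rational functions on a set\<close>

lemma rational_on_add:
  assumes "rational_on I f" "rational_on I g"
  shows "rational_on I (\<lambda>t. f t + g t)"
proof -
  obtain p q where f: "\<forall>t\<in>I. poly q t \<noteq> 0 \<and> f t = poly p t / poly q t"
    using assms(1) unfolding rational_on_def by blast
  obtain a b where g: "\<forall>t\<in>I. poly b t \<noteq> 0 \<and> g t = poly a t / poly b t"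
    using assms(2) unfolding rational_on_def by blast
  have "\<forall>t\<in>I. poly (q * b) t \<noteq> 0 \<and> f t + g t = poly (p * b + a * q) t / poly (q * b) t"
    using f g by (simp add: add_frac_eq)
  then show ?thesis
    unfolding rational_on_def by blast
qed

lemma rational_on_mult:
  assumes "rational_on I f" "rational_on I g"
  shows "rational_on I (\<lambda>t. f t * g t)"
proof -
  obtain p q where f: "\<forall>t\<in>I. poly q t \<noteq> 0 \<and> f t = poly p t / poly q t"
    using assms(1) unfolding rational_on_def by blast
  obtain a b where g: "\<forall>t\<in>I. poly b t \<noteq> 0 \<and> g t = poly a t / poly b t"
    using assms(2) unfolding rational_on_def by blast
  have "\<forall>t\<in>I. poly (q * b) t \<noteq> 0 \<and> f t * g t = poly (p * a) t / poly (q * b) t"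
    using f g by simp
  then show ?thesis
    unfolding rational_on_def by blast
qed

lemma rational_on_divide:
  assumes "rational_on I f" "rational_on I g" and nz: "\<And>t. t \<in> I \<Longrightarrow> g t \<noteq> 0"
  shows "rational_on I (\<lambda>t. f t / g t)"
proof -
  obtain p q where f: "\<forall>t\<in>I. poly q t \<noteq> 0 \<and> f t = poly p t / poly q t"
    using assms(1) unfolding rational_on_def by blast
  obtain a b where g: "\<forall>t\<in>I. poly b t \<noteq> 0 \<and> g t = poly a t / poly b t"
    using assms(2) unfolding rational_on_def by blast
  have "\<forall>t\<in>I. poly (q * a) t \<noteq> 0 \<and> f t / g t = poly (p * b) t / poly (q * a) t"
  proof
    fix t assume "t \<in> I"
    then have "poly a t \<noteq> 0"
      using g nz[of t] by auto
    then show "poly (q * a) t \<noteq> 0 \<and> f t / g t = poly (p * b) t / poly (q * a) t"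
      using f g \<open>t \<in> I\<close> by simp
  qed
  then show ?thesis
    unfolding rational_on_def by blast
qed

lemma rational_on_uminus:
  assumes "rational_on I f"
  shows "rational_on I (\<lambda>t. - f t)"
proof -
  obtain p q where f: "\<forall>t\<in>I. poly q t \<noteq> 0 \<and> f t = poly p t / poly q t"
    using assms unfolding rational_on_def by blast
  then have "\<forall>t\<in>I. poly q t \<noteq> 0 \<and> - f t = poly (- p) t / poly q t"
    by simp
  then show ?thesis
    unfolding rational_on_def by blast
qed

lemma rational_on_diff:
  assumes "rational_on I f" "rational_on I g"
  shows "rational_on I (\<lambda>t. f t - g t)"
  using rational_on_add[OF assms(1) rational_on_uminus[OF assms(2)]] by simp

lemma rational_on_inner:
  assumes "rational_vec_on I u" "rational_vec_on I w"
  shows "rational_on I (\<lambda>t. u t \<bullet> w t)"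
  using assms unfolding rational_vec_on_def inner_vec_def sum_3 inner_real_def
  by (intro rational_on_add rational_on_mult) auto

lemma rational_vec_on_cross:
  assumes "rational_vec_on I u" "rational_vec_on I w"
  shows "rational_vec_on I (\<lambda>t. u t \<times> w t)"
  using assms unfolding rational_vec_on_def forall_3 cross_components
  by (intro conjI rational_on_diff rational_on_mult) auto

section \<open>Derivatives within an interval\<close>

lemma interval_at_within_neq_bot:
  fixes I :: "real set"
  assumes "is_interval I" "interior I \<noteq> {}" "t \<in> I"
  shows "at t within I \<noteq> bot"
proof -
  have "I \<noteq> {x}" for x
    using assms(2) by auto
  then have "t islimpt I"
    using assms by (intro connected_imp_perfect is_interval_connected)
  then show ?thesis
    by (simp add: trivial_limit_within)
qed

lemma deriv_on_eqI:
  assumes "at t within I \<noteq> bot" "(f has_vector_derivative D) (at t within I)"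
  shows "deriv_on I f t = D"
  unfolding deriv_on_def using assms by (rule vector_derivative_within)

text \<open>The quotient rule, recorded with polynomial numerator and denominator, yields both
  differentiability and rationality of the derivative.\<close>

lemma rational_on_derivative:
  assumes "rational_on I f"
  obtains D where "rational_on I D"
    "\<And>t. t \<in> I \<Longrightarrow> (f has_real_derivative D t) (at t within I)"
proof -
  obtain p q where f: "\<forall>t\<in>I. poly q t \<noteq> 0 \<and> f t = poly p t / poly q t"
    using assms unfolding rational_on_def by blast
  define D where "D t = poly (pderiv p * q - p * pderiv q) t / poly (q * q) t" for t
  show thesis
  proof
    show "rational_on I D"
      unfolding rational_on_def D_def using f by (metis mult_eq_0_iff poly_mult)
    fix t assume t: "t \<in> I"
    have "((\<lambda>t. poly p t / poly q t) has_real_derivative D t) (at t within I)"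
      unfolding D_def using f t
      by (auto intro!: DERIV_divide[THEN DERIV_cong] DERIV_subset[OF poly_DERIV])
    then show "(f has_real_derivative D t) (at t within I)"
      using f t unfolding has_real_derivative_iff_has_vector_derivative
      by (metis (no_types, lifting) has_vector_derivative_transform)
  qed
qed

lemma has_vector_derivative_componentwise:
  fixes f :: "real \<Rightarrow> real ^ 'n"
  assumes "\<And>i. ((\<lambda>t. f t $ i) has_real_derivative D $ i) (at t within I)"
  shows "(f has_vector_derivative D) (at t within I)"
  unfolding has_vector_derivative_def
proof (subst has_derivative_componentwise_within, intro ballI)
  fix b :: "real ^ 'n" assume "b \<in> Basis"
  then obtain i where "b = axis i 1"
    by (auto simp: Basis_vec_def)
  then show "((\<lambda>x. f x \<bullet> b) has_derivative (\<lambda>x. (x *\<^sub>R D) \<bullet> b)) (at t within I)"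
    using assms[of i] by (simp add: inner_axis has_field_derivative_def mult.commute[of _ "D $ i"])
qed

text \<open>The derivative within a set is only determined at points which are not isolated, whence
  the hypothesis on \<open>at t within I\<close>.\<close>

lemma rational_on_deriv_on:
  assumes "rational_on I f" and "\<And>t. t \<in> I \<Longrightarrow> at t within I \<noteq> bot" and "t \<in> I"
  shows "(f has_vector_derivative deriv_on I f t) (at t within I)"
proof -
  obtain D where "\<And>t. t \<in> I \<Longrightarrow> (f has_real_derivative D t) (at t within I)"
    using rational_on_derivative[OF assms(1)] by blast
  then have "(f has_vector_derivative D t) (at t within I)"
    using assms(3) by (simp add: has_real_derivative_iff_has_vector_derivative)
  then show ?thesis
    using deriv_on_eqI assms(2,3) by metis
qed

lemma rational_vec_on_deriv_on:
  assumes v: "rational_vec_on I v" and nb: "\<And>t. t \<in> I \<Longrightarrow> at t within I \<noteq> bot"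
  shows "rational_vec_on I (deriv_on I v)"
    and "t \<in> I \<Longrightarrow> (v has_vector_derivative deriv_on I v t) (at t within I)"
proof -
  have "\<forall>i. \<exists>D. rational_on I D \<and>
      (\<forall>t\<in>I. ((\<lambda>t. v t $ i) has_real_derivative D t) (at t within I))"
    using v rational_on_derivative unfolding rational_vec_on_def by metis
  then obtain D where D: "\<And>i. rational_on I (D i)"
    and dD: "\<And>i t. t \<in> I \<Longrightarrow> ((\<lambda>t. v t $ i) has_real_derivative D i t) (at t within I)"
    by metis
  have dv: "(v has_vector_derivative (\<chi> i. D i t)) (at t within I)" if "t \<in> I" for t
    using dD[OF that] by (intro has_vector_derivative_componentwise) simp
  have eq: "deriv_on I v t = (\<chi> i. D i t)" if "t \<in> I" for t
    using deriv_on_eqI[OF nb dv] that by simp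
  show "rational_vec_on I (deriv_on I v)"
    using D eq unfolding rational_vec_on_def rational_on_def by simp
  show "t \<in> I \<Longrightarrow> (v has_vector_derivative deriv_on I v t) (at t within I)"
    using dv eq by simp
qed

section \<open>The frame spanned by two vectors and their cross product\<close>

lemma lin_indep_pair_cross_nonzero:
  fixes x y :: "real ^ 3"
  assumes "lin_indep_pair x y"
  shows "x \<times> y \<noteq> 0"
proof
  assume "x \<times> y = 0"
  then have "x = 0 \<or> y = 0 \<or> (\<exists>c. y = c *\<^sub>R x)"
    by (simp add: cross_eq_0 collinear_lemma)
  moreover have "x \<noteq> y" "independent (insert y {x})"
    using assms unfolding lin_indep_pair_def by (simp_all add: insert_commute)
  then have "x \<noteq> 0" "y \<noteq> 0" "y \<notin> span {x}"
    by (auto simp: dependent_zero independent_insert span_zero)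
  ultimately show False
    by (auto simp: span_singleton)
qed

text \<open>Cramer's rule for the frame \<open>x, y, x \<times> y\<close>, whose determinant is the squared length of
  \<open>x \<times> y\<close>.\<close>

lemma cross_frame_expansion:
  fixes u x y :: "real ^ 3"
  defines "w \<equiv> x \<times> y"
  assumes "w \<noteq> 0"
  shows "u = (u \<bullet> (y \<times> w) / (w \<bullet> w)) *\<^sub>R x + (u \<bullet> (w \<times> x) / (w \<bullet> w)) *\<^sub>R y
    + (u \<bullet> w / (w \<bullet> w)) *\<^sub>R w"
proof -
  have cramer: "(w \<bullet> w) *\<^sub>R u = (u \<bullet> (y \<times> w)) *\<^sub>R x + (u \<bullet> (w \<times> x)) *\<^sub>R y + (u \<bullet> w) *\<^sub>R w"
    unfolding w_def by (simp add: cross3_simps forall_3)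
  have "u = (1 / (w \<bullet> w)) *\<^sub>R ((w \<bullet> w) *\<^sub>R u)"
    using assms(2) by simp
  also have "\<dots> = (u \<bullet> (y \<times> w) / (w \<bullet> w)) *\<^sub>R x + (u \<bullet> (w \<times> x) / (w \<bullet> w)) *\<^sub>R y
    + (u \<bullet> w / (w \<bullet> w)) *\<^sub>R w"
    unfolding cramer by (simp add: scaleR_add_right)
  finally show ?thesis .
qed

text \<open>Orthogonality to \<open>w = x \<times> y\<close> kills the \<open>w\<close>-coefficient in the expansion of \<open>u\<close>, and
  orthogonality to \<open>x \<times> w\<close> the \<open>y\<close>-coefficient.  Naming the remaining coefficient, rather than
  asserting that some factor exists, makes it visible that it depends rationally on the data.\<close>

lemma parallel_iff_orthogonal_cross_frame:
  fixes u x y :: "real ^ 3"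
  defines "w \<equiv> x \<times> y"
  assumes "w \<noteq> 0"
  shows "u = (u \<bullet> (y \<times> w) / (w \<bullet> w)) *\<^sub>R x \<longleftrightarrow> u \<bullet> w = 0 \<and> u \<bullet> (x \<times> w) = 0"
    and "u = c *\<^sub>R x \<Longrightarrow> u \<bullet> w = 0 \<and> u \<bullet> (x \<times> w) = 0"
proof -
  show orth: "u = c *\<^sub>R x \<Longrightarrow> u \<bullet> w = 0 \<and> u \<bullet> (x \<times> w) = 0" for c
    unfolding w_def by (simp add: dot_cross_self)
  show "u = (u \<bullet> (y \<times> w) / (w \<bullet> w)) *\<^sub>R x \<longleftrightarrow> u \<bullet> w = 0 \<and> u \<bullet> (x \<times> w) = 0"
  proof
    assume *: "u \<bullet> w = 0 \<and> u \<bullet> (x \<times> w) = 0"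
    then have "u \<bullet> (w \<times> x) = 0"
      by (subst cross_skew) simp
    then show "u = (u \<bullet> (y \<times> w) / (w \<bullet> w)) *\<^sub>R x"
      using cross_frame_expansion[of x y u] * assms by simp
  qed (rule orth)
qed

text \<open>If \<open>x\<close>, \<open>y\<close>, \<open>z\<close> are \<open>v\<close>, \<open>v'\<close>, \<open>v''\<close>, then \<open>b x + c y + d z + e (x \<times> y) + f (x \<times> z)\<close> is
  the derivative of a combination of \<open>v\<close>, \<open>v'\<close>, \<open>v \<times> v'\<close>; the right-hand sides are the left-hand
  sides of the equations for \<open>a2\<close> and \<open>a1\<close>.\<close>

lemma cross_frame_inner_equations:
  fixes x y z :: "real ^ 3"
  defines "u \<equiv> \<lambda>b c d e f. b *\<^sub>R x + c *\<^sub>R y + d *\<^sub>R z + e *\<^sub>R (x \<times> y) + f *\<^sub>R (x \<times> z)"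
  shows "u b c d e f \<bullet> (x \<times> y) =
      d * det3 x y z + e * ((x \<times> y) \<bullet> (x \<times> y)) + f * ((x \<times> y) \<bullet> (x \<times> z))"
    and "u b c d e f \<bullet> (x \<times> (x \<times> y)) =
      c * det2 (x \<bullet> y) (y \<bullet> y) (x \<bullet> x) (x \<bullet> y)
      + d * det2 (x \<bullet> y) (y \<bullet> z) (x \<bullet> x) (x \<bullet> z) + f * (x \<bullet> x) * det3 x y z"
  unfolding u_def det3_def det2_def det_2 by (simp_all add: cross3_simps)

section \<open>Tangency in terms of frame coefficients\<close>

text \<open>The term \<open>v' \<times> v'\<close> in the derivative of \<open>v \<times> v'\<close> vanishes; this is why only \<open>v \<times> v''\<close>
  accompanies \<open>a3\<close>.\<close>

lemma has_vector_derivative_cross_frame_combination: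
  fixes v v' :: "real \<Rightarrow> real ^ 3"
  assumes "(v has_vector_derivative v' t) (at t within I)"
    and "(v' has_vector_derivative z) (at t within I)"
    and "(a1 has_vector_derivative d1) (at t within I)"
    and "(a2 has_vector_derivative d2) (at t within I)"
    and "(a3 has_vector_derivative d3) (at t within I)"
  shows "((\<lambda>t. a1 t *\<^sub>R v t + a2 t *\<^sub>R v' t + a3 t *\<^sub>R (v t \<times> v' t)) has_vector_derivative
      d1 *\<^sub>R v t + (a1 t + d2) *\<^sub>R v' t + a2 t *\<^sub>R z + d3 *\<^sub>R (v t \<times> v' t)
      + a3 t *\<^sub>R (v t \<times> z)) (at t within I)"
proof -
  have "bounded_bilinear ((\<times>) :: real ^ 3 \<Rightarrow> _)"
    using bilinear_cross by (simp add: bilinear_conv_bounded_bilinear)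
  from bounded_bilinear.has_vector_derivative[OF this assms(1,2)]
  have "((\<lambda>t. v t \<times> v' t) has_vector_derivative v t \<times> z) (at t within I)"
    by simp
  then have "((\<lambda>t. a1 t *\<^sub>R v t + a2 t *\<^sub>R v' t + a3 t *\<^sub>R (v t \<times> v' t)) has_vector_derivative
      (a1 t *\<^sub>R v' t + d1 *\<^sub>R v t) + (a2 t *\<^sub>R z + d2 *\<^sub>R v' t)
      + (a3 t *\<^sub>R (v t \<times> z) + d3 *\<^sub>R (v t \<times> v' t))) (at t within I)"
    using assms unfolding has_real_derivative_iff_has_vector_derivative[symmetric]
    by (intro has_vector_derivative_add has_vector_derivative_scaleR)
  then show ?thesis
    by (simp add: algebra_simps)
qed

theorem proposition2:
  fixes I :: "real set" and v r :: "real \<Rightarrow> real ^ 3"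
  assumes "is_interval I" and "interior I \<noteq> {}"
    and "rational_vec_on I v" and "rational_vec_on I r"
    and "\<forall>t\<in>I. lin_indep_pair (v t) (deriv_on I v t)"
  shows "let v' = deriv_on I v; v'' = deriv_on I v' in
    tangent_on I v r \<longleftrightarrow>
      (\<exists>a3. rational_on I a3 \<and>
        (\<exists>a1 a2. rational_on I a1 \<and> rational_on I a2 \<and>
          (\<forall>t\<in>I.
             r t = a1 t *\<^sub>R v t + a2 t *\<^sub>R v' t + a3 t *\<^sub>R (v t \<times> v' t)) \<and>
          (\<forall>t\<in>I.
             a2 t * det3 (v t) (v' t) (v'' t)
             + deriv_on I a3 t * ((v t \<times> v' t) \<bullet> (v t \<times> v' t))
             + a3 t * ((v t \<times> v' t) \<bullet> (v t \<times> v'' t)) = 0) \<and>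
          (\<forall>t\<in>I.
             (a1 t + deriv_on I a2 t)
               * det2 (v t \<bullet> v' t) (v' t \<bullet> v' t)
                      (v t \<bullet> v t)  (v t \<bullet> v' t)
             + a2 t
               * det2 (v t \<bullet> v' t) (v' t \<bullet> v'' t)
                      (v t \<bullet> v t)  (v t \<bullet> v'' t)
             + a3 t * (v t \<bullet> v t) * det3 (v t) (v' t) (v'' t) = 0)))"
proof -
  define v' v'' where "v' = deriv_on I v" and "v'' = deriv_on I v'"
  define w where "w t = v t \<times> v' t" for t
  have nb: "at t within I \<noteq> bot" if "t \<in> I" for t
    using interval_at_within_neq_bot assms(1,2) that by blast
  have rv': "rational_vec_on I v'" and rr': "rational_vec_on I (deriv_on I r)"
    unfolding v'_def using rational_vec_on_deriv_on(1) nb assms(3,4) by blast+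
  have dv: "(v has_vector_derivative v' t) (at t within I)"
    and dv': "(v' has_vector_derivative v'' t) (at t within I)" if "t \<in> I" for t
    using rational_vec_on_deriv_on(2)[OF assms(3) nb that]
      rational_vec_on_deriv_on(2)[OF rv' nb that] unfolding v''_def v'_def by auto
  have rw: "rational_vec_on I w"
    unfolding w_def using assms(3) rv' by (rule rational_vec_on_cross)
  have w0: "w t \<noteq> 0" if "t \<in> I" for t
    using assms(5) that lin_indep_pair_cross_nonzero unfolding w_def v'_def by blast
  have rational_quotient: "rational_on I (\<lambda>t. f t \<bullet> h t / (w t \<bullet> w t))"
    if "rational_vec_on I f" "rational_vec_on I h" for f h
    using that rw w0 by (intro rational_on_divide rational_on_inner) auto
  \<comment> \<open>The factor of tangency may be taken to be the Cramer coefficient, which is rational.\<close>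
  have tangent_iff: "tangent_on I v r \<longleftrightarrow>
      (\<forall>t\<in>I. deriv_on I r t \<bullet> w t = 0 \<and> deriv_on I r t \<bullet> (v t \<times> w t) = 0)"
  proof
    assume "tangent_on I v r"
    then show "\<forall>t\<in>I. deriv_on I r t \<bullet> w t = 0 \<and> deriv_on I r t \<bullet> (v t \<times> w t) = 0"
      using parallel_iff_orthogonal_cross_frame(2) w0 unfolding tangent_on_def w_def by blast
  next
    assume orth: "\<forall>t\<in>I. deriv_on I r t \<bullet> w t = 0 \<and> deriv_on I r t \<bullet> (v t \<times> w t) = 0"
    have "rational_on I (\<lambda>t. deriv_on I r t \<bullet> (v' t \<times> w t) / (w t \<bullet> w t))"
      using rr' rv' rw by (intro rational_quotient rational_vec_on_cross)
    moreover have "deriv_on I r t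
        = (deriv_on I r t \<bullet> (v' t \<times> w t) / (w t \<bullet> w t)) *\<^sub>R v t" if "t \<in> I" for t
      using parallel_iff_orthogonal_cross_frame(1)[of "v t" "v' t" "deriv_on I r t"]
        orth w0 that unfolding w_def by blast
    ultimately show "tangent_on I v r"
      unfolding tangent_on_def by blast
  qed
  \<comment> \<open>For rational coefficients of \<open>r\<close> in the frame, the two orthogonality conditions become the
    two scalar equations.\<close>
  have equations: "deriv_on I r t \<bullet> w t =
        a2 t * det3 (v t) (v' t) (v'' t)
        + deriv_on I a3 t * ((v t \<times> v' t) \<bullet> (v t \<times> v' t))
        + a3 t * ((v t \<times> v' t) \<bullet> (v t \<times> v'' t))" (is ?eq2)
      "deriv_on I r t \<bullet> (v t \<times> w t) =
        (a1 t + deriv_on I a2 t) * det2 (v t \<bullet> v' t) (v' t \<bullet> v' t) (v t \<bullet> v t) (v t \<bullet> v' t)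
        + a2 t * det2 (v t \<bullet> v' t) (v' t \<bullet> v'' t) (v t \<bullet> v t) (v t \<bullet> v'' t)
        + a3 t * (v t \<bullet> v t) * det3 (v t) (v' t) (v'' t)" (is ?eq1)
    if a: "rational_on I a1" "rational_on I a2" "rational_on I a3"
      and r: "\<forall>t\<in>I. r t = a1 t *\<^sub>R v t + a2 t *\<^sub>R v' t + a3 t *\<^sub>R (v t \<times> v' t)"
      and t: "t \<in> I" for a1 a2 a3 t
  proof -
    have "((\<lambda>t. a1 t *\<^sub>R v t + a2 t *\<^sub>R v' t + a3 t *\<^sub>R (v t \<times> v' t)) has_vector_derivative
        deriv_on I a1 t *\<^sub>R v t + (a1 t + deriv_on I a2 t) *\<^sub>R v' t + a2 t *\<^sub>R v'' t
        + deriv_on I a3 t *\<^sub>R (v t \<times> v' t) + a3 t *\<^sub>R (v t \<times> v'' t)) (at t within I)"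
      using dv[OF t] dv'[OF t] a nb t
      by (intro has_vector_derivative_cross_frame_combination rational_on_deriv_on) auto
    then have "(r has_vector_derivative
        deriv_on I a1 t *\<^sub>R v t + (a1 t + deriv_on I a2 t) *\<^sub>R v' t + a2 t *\<^sub>R v'' t
        + deriv_on I a3 t *\<^sub>R (v t \<times> v' t) + a3 t *\<^sub>R (v t \<times> v'' t)) (at t within I)"
      using r t by (intro has_vector_derivative_transform[of t I r]) auto
    from deriv_on_eqI[OF nb[OF t] this] show ?eq2 ?eq1
      unfolding w_def by (simp_all only: cross_frame_inner_equations)
  qed
  have coefficients: "\<exists>a1 a2 a3. rational_on I a1 \<and> rational_on I a2 \<and> rational_on I a3 \<and>
      (\<forall>t\<in>I. r t = a1 t *\<^sub>R v t + a2 t *\<^sub>R v' t + a3 t *\<^sub>R (v t \<times> v' t))"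
  proof (intro exI conjI ballI)
    show "rational_on I (\<lambda>t. r t \<bullet> (v' t \<times> w t) / (w t \<bullet> w t))"
      "rational_on I (\<lambda>t. r t \<bullet> (w t \<times> v t) / (w t \<bullet> w t))"
      "rational_on I (\<lambda>t. r t \<bullet> w t / (w t \<bullet> w t))"
      by (intro rational_quotient rational_vec_on_cross assms(3,4) rv' rw)+
    show "r t = (r t \<bullet> (v' t \<times> w t) / (w t \<bullet> w t)) *\<^sub>R v t
        + (r t \<bullet> (w t \<times> v t) / (w t \<bullet> w t)) *\<^sub>R v' t
        + (r t \<bullet> w t / (w t \<bullet> w t)) *\<^sub>R (v t \<times> v' t)" if "t \<in> I" for t
      using cross_frame_expansion w0[OF that] unfolding w_def by blast
  qed
  show ?thesis
    unfolding Let_def v'_def[symmetric] v''_def[symmetric] tangent_iff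
  proof (intro iffI, goal_cases)
    case 1
    obtain a1 a2 a3 where "rational_on I a1" "rational_on I a2" "rational_on I a3"
      "\<forall>t\<in>I. r t = a1 t *\<^sub>R v t + a2 t *\<^sub>R v' t + a3 t *\<^sub>R (v t \<times> v' t)"
      using coefficients by blast
    note a = this
    show ?case
      by (rule exI[of _ a3], rule conjI[OF a(3)], rule exI[of _ a1], rule exI[of _ a2])
        (use a 1 equations[OF a] in simp)
  next
    case 2
    then obtain a1 a2 a3 where a: "rational_on I a1" "rational_on I a2" "rational_on I a3"
      "\<forall>t\<in>I. r t = a1 t *\<^sub>R v t + a2 t *\<^sub>R v' t + a3 t *\<^sub>R (v t \<times> v' t)"
      and eqs: "\<forall>t\<in>I. a2 t * det3 (v t) (v' t) (v'' t)
             + deriv_on I a3 t * ((v t \<times> v' t) \<bullet> (v t \<times> v' t))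
             + a3 t * ((v t \<times> v' t) \<bullet> (v t \<times> v'' t)) = 0"
        "\<forall>t\<in>I. (a1 t + deriv_on I a2 t)
               * det2 (v t \<bullet> v' t) (v' t \<bullet> v' t) (v t \<bullet> v t)  (v t \<bullet> v' t)
             + a2 t * det2 (v t \<bullet> v' t) (v' t \<bullet> v'' t) (v t \<bullet> v t)  (v t \<bullet> v'' t)
             + a3 t * (v t \<bullet> v t) * det3 (v t) (v' t) (v'' t) = 0"
      by blast
    show ?case
      using eqs equations[OF a] by simp
  qed
qed

end
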